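(* Let $\lambda_\ell$ be generated by the Dinkelbach–Newton method (described in the context) for the fractional problem $\max_{E\in\mathcal{S}_{\mathcal{T}}(\Omega)}\int_Ep_k\,dx/\mathrm{Per}(E,\Omega)$. Then there is $L\in\mathbb{N}$ such that $\lambda_L=\bar\lambda_k$, i.e. the method stops after finitely many steps.
   Context: $\Omega\subset\mathbb{R}^d$ ($d\ge 2$) is a bounded polyhedral (connected) domain with strongly Lipschitz boundary; $\mathcal{T}=\{T_1,\dots,T_n\}$ is a triangulation: pairwise disjoint open simplices with $\overline\Omega=\bigcup_i\overline{T_i}$. $P_0(\mathcal{T})$ is the space of functions constant on each simplex; $\mathcal{S}_{\mathcal{T}}(\Omega)$ is the class of open sets that are interiors of unions of closures of simplices of $\mathcal{T}$ (including $\emptyset$ and $\Omega$). $\mathrm{TV}$ is the usual isotropic total variation in $\Omega$, $\mathrm{Per}(E,\Omega)=\mathrm{TV}(\mathbb{1}_E,\Omega)$. FC-GCG method with $V=P_0(\mathcal{T})$ for $\min_{u\in V}F(Ku)+\mathrm{TV}(u,\Omega)$: $Y$ is a separable Hilbert space, $K:V\to Y$ linear and continuous, $F:Y\to\mathbb{R}$ thrice continuously Fréchet differentiable, strictly convex, $F\ge0$, and with $K_{\mathbb{1}}=K\mathbb{1}_\Omega$ for every $y$ the map $c\mapsto F(y+cK_{\mathbb{1}})$ has a unique minimizer in $\mathbb{R}$. Let $B=\{u\in V:\int_\Omega u\,dx=0,\ \mathrm{TV}(u,\Omega)\le1\}$. Start with $\mathcal{A}_0=\emptyset$, $u_0=c^0\mathbb{1}_\Omega$,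 $c^0\in\operatorname{argmin}_cF(cK_{\mathbb{1}})$. In step $k$: $p_k=-K^*\nabla F(Ku_k)$; pick an extremal point $\widehat v_k$ of $B$ maximizing $v\mapsto\int_\Omega p_kv\,dx$; stop if the maximum is $\le1$; otherwise let $\mathcal{A}_k^+=\mathcal{A}_k\cup\{\widehat v_k\}=\{v_1,\dots,v_N\}$, let $(\gamma^{k+1},c^{k+1})$ minimize $F(\sum_i\gamma_iKv_i+cK_{\mathbb{1}})+\sum_i\gamma_i$ over $\gamma\ge0$, $c\in\mathbb{R}$, put $u_{k+1}=\sum_i\gamma_i^{k+1}v_i+c^{k+1}\mathbb{1}_\Omega$ and obtain $\mathcal{A}_{k+1}$ from $\mathcal{A}_k^+$ by removing elements with zero weight. The dual variable $p_k$ is identified with an element of $P_0(\mathcal{T})$ (via the $L^2$ inner product) and satisfies $\int_\Omega p_k\,dx=0$. $\bar\lambda_k:=\Big(\max_{E}\frac{\int_Ep_k\,dx}{\mathrm{Per}(E,\Omega)}\Big)^{-1}$, the maximum being over $E\in\mathcal{S}_{\mathcal{T}}(\Omega)$ with $\mathrm{Per}(E,\Omega)\ne0$; it is a standing assumption that the maximum is at least $1$, i.e. $0<\bar\lambda_k\le1$. Dinkelbach–Newton method: for $\lambda\ge0$ let $G(\lambda)=\min_{E\in\mathcal{S}_{\mathcal{T}}(\Omega)}[\mathrm{Per}(E,\Omega)-\lambda\int_Ep_k\,dx]$ and let $E_\lambda$ be an arbitrary minimizer. Set $\lambda_0=1$ and compute $E_{\lambda_0}$. For $\ell=0,1,2,\dots$: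 if $G(\lambda_\ell)=0$, stop; otherwise set $\lambda_{\ell+1}=\mathrm{Per}(E_{\lambda_\ell},\Omega)\big/\int_{E_{\lambda_\ell}}p_k\,dx$ and compute $E_{\lambda_{\ell+1}}$. ($\mathbb{N}$ includes $0$ here.) *)

theory Defs
  imports "HOL-Analysis.Analysis" "HOL-Library.Function_Algebras"
begin

text \<open>Pointwise scaling makes real functions a real vector space, so that \<open>(extreme_point_of)\<close>
  and \<open>subspace\<close> apply to spaces of functions.\<close>

instantiation "fun" :: (type, real_vector) real_vector
begin

definition scaleR_fun :: "real \<Rightarrow> ('a \<Rightarrow> 'b) \<Rightarrow> 'a \<Rightarrow> 'b" where
  "scaleR_fun c f = (\<lambda>x. c *\<^sub>R f x)"

instance
  by standard (auto simp: scaleR_fun_def fun_eq_iff scaleR_add_right scaleR_add_left)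

end


section \<open>Polyhedral Lipschitz domains and triangulations\<close>

text \<open>Strongly Lipschitz boundary: near every boundary point, and with respect to a suitable
  direction \<open>e\<close>, the set is the strict epigraph of a Lipschitz function on the hyperplane
  orthogonal to \<open>e\<close>; in particular it lies on one side of its boundary.\<close>

definition strongly_lipschitz_boundary :: "'a::euclidean_space set \<Rightarrow> bool" where
  "strongly_lipschitz_boundary \<Omega> \<longleftrightarrow>
     (\<forall>x\<in>frontier \<Omega>. \<exists>U e g L.
        open U \<and> x \<in> U \<and> norm e = 1 \<and>
        L-lipschitz_on {z. z \<bullet> e = 0} (g :: 'a \<Rightarrow> real) \<and>
        \<Omega> \<inter> U = {y \<in> U. y \<bullet> e > g (y - (y \<bullet> e) *\<^sub>R e)})"

definition polyhedral_lipschitz_domain :: "'a::euclidean_space set \<Rightarrow> bool" where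
  "polyhedral_lipschitz_domain \<Omega> \<longleftrightarrow>
     open \<Omega> \<and> connected \<Omega> \<and> \<Omega> \<noteq> {} \<and> bounded \<Omega> \<and>
     (\<exists>\<P>. finite \<P> \<and> (\<forall>P\<in>\<P>. polytope P) \<and> closure \<Omega> = \<Union>\<P>) \<and>
     strongly_lipschitz_boundary \<Omega>"

definition open_simplex :: "'a::euclidean_space set \<Rightarrow> bool" where
  "open_simplex T \<longleftrightarrow> (\<exists>S. int DIM('a) simplex S \<and> T = interior S)"

text \<open>Hanging nodes are allowed: no conformity is required of adjacent simplices.\<close>

definition domain_triangulation :: "'a::euclidean_space set \<Rightarrow> 'a set set \<Rightarrow> bool" where
  "domain_triangulation \<Omega> \<T> \<longleftrightarrow>
     finite \<T> \<and> (\<forall>T\<in>\<T>. open_simplex T) \<and> pairwise disjnt \<T> \<and>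
     closure \<Omega> = (\<Union>T\<in>\<T>. closure T)"

definition simplex_sets :: "'a::euclidean_space set set \<Rightarrow> 'a set set" where
  "simplex_sets \<T> = {interior (\<Union>T\<in>\<C>. closure T) |\<C>. \<C> \<subseteq> \<T>}"

text \<open>Elements of \<open>P\<^sub>0(\<T>)\<close> are determined up to null sets by their values on the simplices. The
  representative vanishing off the open simplices is used throughout, which turns equality almost
  everywhere into equality. The representative of the constant function \<open>1\<close> on \<open>\<Omega>\<close> is
  \<open>one_P0\<close>.\<close>

definition P0 :: "'a::euclidean_space set set \<Rightarrow> ('a \<Rightarrow> real) set" where
  "P0 \<T> = {u. (\<forall>T\<in>\<T>. u constant_on T) \<and> (\<forall>x. x \<notin> \<Union>\<T> \<longrightarrow> u x = 0)}"

definition one_P0 :: "'a::euclidean_space set set \<Rightarrow> 'a \<Rightarrow> real" where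
  "one_P0 \<T> = indicator (\<Union>\<T>)"


section \<open>Total variation and perimeter\<close>

definition divergence :: "('a::euclidean_space \<Rightarrow> 'a) \<Rightarrow> 'a \<Rightarrow> real" where
  "divergence \<phi> x = (\<Sum>b\<in>Basis. frechet_derivative \<phi> (at x) b \<bullet> b)"

definition C1c :: "'a::euclidean_space set \<Rightarrow> ('a \<Rightarrow> 'a) set" where
  "C1c \<Omega> =
     {\<phi>. (\<exists>D :: 'a \<Rightarrow> 'a \<Rightarrow>\<^sub>L 'a. (\<forall>x. (\<phi> has_derivative blinfun_apply (D x)) (at x)) \<and>
                              continuous_on UNIV D) \<and>
         compact (closure {x. \<phi> x \<noteq> 0}) \<and> closure {x. \<phi> x \<noteq> 0} \<subseteq> \<Omega>}"

definition TV :: "('a::euclidean_space \<Rightarrow> real) \<Rightarrow> 'a set \<Rightarrow> ereal" where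
  "TV u \<Omega> = (SUP \<phi>\<in>{\<phi> \<in> C1c \<Omega>. \<forall>x. norm (\<phi> x) \<le> 1}.
               ereal (LINT x:\<Omega>|lborel. u x * divergence \<phi> x))"

definition Per :: "'a::euclidean_space set \<Rightarrow> 'a set \<Rightarrow> ereal" where
  "Per E \<Omega> = TV (indicator E) \<Omega>"


section \<open>The FC-GCG method on \<open>P\<^sub>0(\<T>)\<close>\<close>

text \<open>Linearity of \<open>K\<close> and continuity with respect to the \<open>L\<^sup>2\<close> norm; \<open>P\<^sub>0(\<T>)\<close> is
  finite-dimensional, so that every norm gives the same notion. Values of \<open>K\<close> off \<open>P\<^sub>0(\<T>)\<close> are
  irrelevant.\<close>

definition bounded_linear_on_P0 ::
    "'a::euclidean_space set \<Rightarrow> 'a set set \<Rightarrow> (('a \<Rightarrow> real) \<Rightarrow> 'y::real_normed_vector) \<Rightarrow> bool" where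
  "bounded_linear_on_P0 \<Omega> \<T> K \<longleftrightarrow>
     (\<forall>u\<in>P0 \<T>. \<forall>v\<in>P0 \<T>. K (u + v) = K u + K v) \<and>
     (\<forall>c. \<forall>u\<in>P0 \<T>. K (c *\<^sub>R u) = c *\<^sub>R K u) \<and>
     (\<exists>C. \<forall>u\<in>P0 \<T>. norm (K u) \<le> C * sqrt (LINT x:\<Omega>|lborel. (u x)\<^sup>2))"

definition thrice_continuously_differentiable :: "('y::real_normed_vector \<Rightarrow> real) \<Rightarrow> bool" where
  "thrice_continuously_differentiable F \<longleftrightarrow>
     (\<exists>(F1 :: 'y \<Rightarrow> 'y \<Rightarrow>\<^sub>L real) (F2 :: 'y \<Rightarrow> 'y \<Rightarrow>\<^sub>L 'y \<Rightarrow>\<^sub>L real) (F3 :: 'y \<Rightarrow> 'y \<Rightarrow>\<^sub>L 'y \<Rightarrow>\<^sub>L 'y \<Rightarrow>\<^sub>L real).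
        (\<forall>y. (F has_derivative blinfun_apply (F1 y)) (at y)) \<and>
        (\<forall>y. (F1 has_derivative blinfun_apply (F2 y)) (at y)) \<and>
        (\<forall>y. (F2 has_derivative blinfun_apply (F3 y)) (at y)) \<and>
        continuous_on UNIV F3)"

definition strictly_convex :: "('y::real_vector \<Rightarrow> real) \<Rightarrow> bool" where
  "strictly_convex F \<longleftrightarrow>
     (\<forall>x y t. x \<noteq> y \<and> 0 < t \<and> t < 1 \<longrightarrow>
        F ((1 - t) *\<^sub>R x + t *\<^sub>R y) < (1 - t) * F x + t * F y)"

definition TV_unit_ball :: "'a::euclidean_space set \<Rightarrow> 'a set set \<Rightarrow> ('a \<Rightarrow> real) set" where
  "TV_unit_ball \<Omega> \<T> = {u \<in> P0 \<T>. (LINT x:\<Omega>|lborel. u x) = 0 \<and> TV u \<Omega> \<le> 1}"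

text \<open>\<open>p = - K\<^sup>* \<nabla>F(K u)\<close>, the adjoint being taken with respect to the \<open>L\<^sup>2\<close> inner product on
  \<open>P\<^sub>0(\<T>)\<close>; \<open>g\<close> is the gradient \<open>\<nabla>F(K u)\<close>.\<close>

definition dual_variable ::
    "'a::euclidean_space set \<Rightarrow> 'a set set \<Rightarrow> (('a \<Rightarrow> real) \<Rightarrow> 'y::real_inner) \<Rightarrow> ('y \<Rightarrow> real) \<Rightarrow>
     ('a \<Rightarrow> real) \<Rightarrow> ('a \<Rightarrow> real) \<Rightarrow> bool" where
  "dual_variable \<Omega> \<T> K F u p \<longleftrightarrow>
     p \<in> P0 \<T> \<and>
     (\<exists>g. GDERIV F (K u) :> g \<and>
          (\<forall>v\<in>P0 \<T>. (LINT x:\<Omega>|lborel. p x * v x) = - (g \<bullet> K v)))"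

text \<open>\<open>fc_gcg_iterate \<Omega> \<T> K F k A u\<close>: some run of the method, with arbitrary choices of extremal
  points and of subproblem solutions, reaches step \<open>k\<close> with active set \<open>A\<close> and iterate \<open>u\<close>.
  The condition \<open>1 < (LINT x:\<Omega>|lborel. p x * v x)\<close> says that the method did not stop. The weights
  \<open>\<gamma>\<close> are indexed by the elements of the extended active set.\<close>

inductive fc_gcg_iterate ::
    "'a::euclidean_space set \<Rightarrow> 'a set set \<Rightarrow> (('a \<Rightarrow> real) \<Rightarrow> 'y::real_inner) \<Rightarrow> ('y \<Rightarrow> real) \<Rightarrow>
     nat \<Rightarrow> ('a \<Rightarrow> real) set \<Rightarrow> ('a \<Rightarrow> real) \<Rightarrow> bool"
  for \<Omega> \<T> K F where
  init:
    "is_arg_min (\<lambda>c. F (c *\<^sub>R K (one_P0 \<T>))) (\<lambda>_. True) c \<Longrightarrow>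
     fc_gcg_iterate \<Omega> \<T> K F 0 {} (c *\<^sub>R one_P0 \<T>)"
| step:
    "\<lbrakk>fc_gcg_iterate \<Omega> \<T> K F k A u;
      dual_variable \<Omega> \<T> K F u p;
      v extreme_point_of TV_unit_ball \<Omega> \<T>;
      is_arg_max (\<lambda>w. LINT x:\<Omega>|lborel. p x * w x) (\<lambda>w. w \<in> TV_unit_ball \<Omega> \<T>) v;
      1 < (LINT x:\<Omega>|lborel. p x * v x);
      A_plus = insert v A;
      is_arg_min
        (\<lambda>(\<gamma>, c). F ((\<Sum>w\<in>A_plus. \<gamma> w *\<^sub>R K w) + c *\<^sub>R K (one_P0 \<T>)) + (\<Sum>w\<in>A_plus. \<gamma> w))
        (\<lambda>(\<gamma>, c). \<forall>w\<in>A_plus. 0 \<le> \<gamma> w) (\<gamma>, c)\<rbrakk> \<Longrightarrow>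
     fc_gcg_iterate \<Omega> \<T> K F (Suc k) {w \<in> A_plus. \<gamma> w \<noteq> 0}
       ((\<Sum>w\<in>A_plus. \<gamma> w *\<^sub>R w) + c *\<^sub>R one_P0 \<T>)"


section \<open>The fractional problem and the Dinkelbach--Newton method\<close>

text \<open>\<open>Per\<close> is extended-real valued, so that its definition does not presuppose finiteness. A set
  of infinite perimeter would contribute the ratio \<open>0\<close>, by \<open>real_of_ereal \<infinity> = 0\<close>, as expected
  of a quotient by \<open>\<infinity>\<close>.\<close>

definition ratios :: "'a::euclidean_space set \<Rightarrow> 'a set set \<Rightarrow> ('a \<Rightarrow> real) \<Rightarrow> real set" where
  "ratios \<Omega> \<T> p =
     {(LINT x:E|lborel. p x) / real_of_ereal (Per E \<Omega>) |E. E \<in> simplex_sets \<T> \<and> Per E \<Omega> \<noteq> 0}"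

definition lambda_bar :: "'a::euclidean_space set \<Rightarrow> 'a set set \<Rightarrow> ('a \<Rightarrow> real) \<Rightarrow> real" where
  "lambda_bar \<Omega> \<T> p = inverse (Max (ratios \<Omega> \<T> p))"

definition dinkelbach_objective ::
    "'a::euclidean_space set \<Rightarrow> ('a \<Rightarrow> real) \<Rightarrow> real \<Rightarrow> 'a set \<Rightarrow> ereal" where
  "dinkelbach_objective \<Omega> p lam E = Per E \<Omega> - ereal (lam * (LINT x:E|lborel. p x))"

definition dinkelbach_G ::
    "'a::euclidean_space set \<Rightarrow> 'a set set \<Rightarrow> ('a \<Rightarrow> real) \<Rightarrow> real \<Rightarrow> ereal" where
  "dinkelbach_G \<Omega> \<T> p lam = Min (dinkelbach_objective \<Omega> p lam ` simplex_sets \<T>)"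

text \<open>\<open>(lams l, E l)\<close> is the \<open>l\<close>-th pair computed by the method. The sequences are constrained only up
  to the first index at which the method stops; later entries are arbitrary.\<close>

definition dinkelbach_newton ::
    "'a::euclidean_space set \<Rightarrow> 'a set set \<Rightarrow> ('a \<Rightarrow> real) \<Rightarrow> (nat \<Rightarrow> real) \<Rightarrow> (nat \<Rightarrow> 'a set) \<Rightarrow> bool"
  where
  "dinkelbach_newton \<Omega> \<T> p lams E \<longleftrightarrow>
     lams 0 = 1 \<and>
     (\<forall>l. (\<forall>j<l. dinkelbach_G \<Omega> \<T> p (lams j) \<noteq> 0) \<longrightarrow>
        is_arg_min (dinkelbach_objective \<Omega> p (lams l)) (\<lambda>E'. E' \<in> simplex_sets \<T>) (E l) \<and>
        (dinkelbach_G \<Omega> \<T> p (lams l) \<noteq> 0 \<longrightarrow>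
           lams (Suc l) = real_of_ereal (Per (E l) \<Omega>) / (LINT x:E l|lborel. p x)))"

end

theory Submission
  imports Defs
begin

text \<open>
  Write \<open>I(E)\<close> for the integral of the dual variable over \<open>E\<close> and \<open>M\<close> for the largest ratio
  \<open>I(E) / Per(E)\<close>. Only finitely many sets \<open>E\<close> compete. While \<open>G(\<lambda>) < 0\<close>, a minimizer \<open>E\<close>
  satisfies \<open>Per(E) < \<lambda> I(E)\<close>, so the Newton update \<open>Per(E) / I(E)\<close> is smaller than \<open>\<lambda>\<close>; being the
  reciprocal of a competing ratio, it is at least \<open>1 / M\<close> and belongs to a finite set. A strictly
  decreasing sequence cannot stay in a finite set, so \<open>G(\<lambda>) = 0\<close> is reached. There
  \<open>\<lambda> \<ge> 1 / M\<close> by the invariant, which holds at the start because \<open>M \<ge> 1\<close>,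
  and testing \<open>G(\<lambda>) = 0\<close> with a set of maximal ratio gives \<open>\<lambda> \<le> 1 / M\<close>. This is \<open>dinkelbach_finite_termination\<close>.

  The ratios only concern sets of positive perimeter, so the argument needs \<open>I(E) = 0\<close> for every
  competing set of perimeter zero; otherwise such a set with \<open>I(E) > 0\<close> could be the minimizer and
  the next iterate would be \<open>0\<close>.
  Two facts give this.

  First, connectedness of \<open>\<Omega>\<close> forces such a set to be empty or all of \<open>\<Omega>\<close>
  (\<open>simplex_set_zero_perimeter\<close>). Indeed, if the perimeter vanishes, the integral over \<open>E\<close> of a
  compactly supported bump does not change when the bump is translated inside \<open>\<Omega>\<close>, because its
  derivative is the integral over \<open>E\<close> of a divergence. Near a point of \<open>\<Omega>\<close> adherent both to \<open>E\<close>
  and to the complement of its closure, the bump could be moved from a place inside \<open>E\<close>, where the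
  integral is positive, to a place off \<open>E\<close>, where it is zero. Hence there is no such point; as
  \<open>E\<close> is regular open, \<open>E\<close> is relatively closed in \<open>\<Omega>\<close>.

  Secondly, the dual variable has mean zero (\<open>dual_variable_integral_zero\<close>): each iterate of the
  method minimizes \<open>F \<circ> K\<close> along the constants, and the derivative in that direction is minus the
  integral of the dual variable.
\<close>

section \<open>A translation-invariance test for zero perimeter\<close>

text \<open>The difference quotient differs from \<open>D\<close> by at most \<open>C * \<bar>h\<bar>\<close>. Bumps and their
  integrals will have quadratic Taylor remainders with explicit constants, so that this criterion
  takes the place of a theorem on differentiation under the integral sign.\<close>

lemma has_real_derivative_quadratic_remainder:
  fixes f :: "real \<Rightarrow> real"
  assumes rem: "\<And>h. \<bar>h\<bar> \<le> 1 \<Longrightarrow> \<bar>f (x + h) - f x - D * h\<bar> \<le> C * h\<^sup>2"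
  shows "(f has_real_derivative D) (at x)"
proof -
  have bnd: "\<bar>(f (x + h) - f x) / h - D\<bar> \<le> C * \<bar>h\<bar>" if "h \<noteq> 0" "\<bar>h\<bar> \<le> 1" for h
  proof -
    have "(f (x + h) - f x) / h - D = (f (x + h) - f x - D * h) / h"
      using that by (simp add: field_simps)
    then show ?thesis
      using rem[OF that(2)] that by (simp add: divide_le_eq power2_eq_square mult.assoc)
  qed
  have "((\<lambda>h. (f (x + h) - f x) / h - D) \<longlongrightarrow> 0) (at 0)"
  proof (rule Lim_null_comparison)
    show "\<forall>\<^sub>F h in at 0. norm ((f (x + h) - f x) / h - D) \<le> C * \<bar>h\<bar>"
      unfolding eventually_at using bnd by (intro exI[of _ 1]) (auto simp: dist_real_def)
    have "((\<lambda>h. C * \<bar>h\<bar>) \<longlongrightarrow> C * \<bar>0\<bar>) (at (0::real))"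
      by (intro tendsto_intros)
    then show "((\<lambda>h. C * \<bar>h\<bar>) \<longlongrightarrow> 0) (at (0::real))" by simp
  qed
  then show ?thesis
    by (simp add: DERIV_def LIM_zero_iff)
qed

text \<open>The square of the positive part is differentiable with a derivative of Lipschitz constant \<open>2\<close>,
  which bounds the remainder uniformly, also across the kink at \<open>0\<close>.\<close>

lemma max_zero_square_remainder:
  "\<bar>(max 0 (s + k))\<^sup>2 - (max 0 s)\<^sup>2 - 2 * k * max 0 s\<bar> \<le> (k::real)\<^sup>2"
proof -
  have *: "(max 0 (s + k))\<^sup>2 - (max 0 s)\<^sup>2 - 2 * k * max 0 s =
     (if 0 \<le> s \<and> 0 \<le> s + k then k\<^sup>2 else if 0 \<le> s then k\<^sup>2 - (s + k)\<^sup>2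
      else if 0 \<le> s + k then (s + k)\<^sup>2 else 0)"
    by (auto simp: max_def power2_eq_square algebra_simps)
  have "(s + k)\<^sup>2 \<le> k\<^sup>2" if "0 \<le> s \<longleftrightarrow> \<not> 0 \<le> s + k"
    using that by (subst abs_le_square_iff[symmetric]) arith
  then show ?thesis unfolding * by (auto simp: abs_le_iff)
qed

text \<open>A compactly supported bump of class \<open>C\<^sup>1\<close>. A polynomial of the squared norm, cut off by the
  positive part, is preferred to a smooth exponential bump because its Taylor remainder is
  quadratic with an explicit constant.\<close>

definition bump :: "real \<Rightarrow> 'a::euclidean_space \<Rightarrow> real" where
  "bump \<epsilon> z = (max 0 (\<epsilon>\<^sup>2 - z \<bullet> z))\<^sup>2"

lemma bump_nonneg: "0 \<le> bump \<epsilon> z"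
  by (simp add: bump_def)

lemma bump_eq_0_iff: "0 < \<epsilon> \<Longrightarrow> bump \<epsilon> z = 0 \<longleftrightarrow> \<epsilon> \<le> norm z"
  by (auto simp: bump_def max_def power2_norm_eq_inner[symmetric] abs_le_square_iff[symmetric]
      power2_le_iff_abs_le power_mono)

lemma bump_le: "bump \<epsilon> z \<le> \<epsilon> ^ 4"
proof -
  have "(max 0 (\<epsilon>\<^sup>2 - z \<bullet> z))\<^sup>2 \<le> (\<epsilon>\<^sup>2)\<^sup>2"
    by (rule power_mono) auto
  then show ?thesis by (simp add: bump_def power_mult[symmetric])
qed

lemma bump_has_derivative:
  "((\<lambda>x. bump \<epsilon> (x - y)) has_derivative
      (\<lambda>h. - (4 * max 0 (\<epsilon>\<^sup>2 - (x - y) \<bullet> (x - y)) * ((x - y) \<bullet> h)))) (at x)"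
proof -
  let ?r = "\<lambda>x. \<epsilon>\<^sup>2 - (x - y) \<bullet> (x - y)"
  have q: "((\<lambda>s. (max 0 s)\<^sup>2) has_real_derivative 2 * max 0 s) (at s)" for s :: real
    using max_zero_square_remainder[of s]
    by (intro has_real_derivative_quadratic_remainder[where C = 1]) (simp add: mult_ac)
  have r: "(?r has_derivative (\<lambda>h. - (2 * ((x - y) \<bullet> h)))) (at x)"
    by (auto intro!: derivative_eq_intros simp: inner_commute)
  show ?thesis
    using has_derivative_compose[OF r q[THEN has_field_derivative_imp_has_derivative]]
    by (simp add: bump_def mult_ac)
qed

lemma continuous_on_bump [continuous_intros]:
  "continuous_on S f \<Longrightarrow> continuous_on S (\<lambda>x. bump \<epsilon> (f x))"
  unfolding bump_def by (intro continuous_intros)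

text \<open>With \<open>s = \<epsilon>\<^sup>2 - |z|\<^sup>2\<close>, shifting \<open>z\<close> by \<open>h v\<close> replaces \<open>s\<close> by \<open>s + k\<close> where
  \<open>k = 2 h (z \<bullet> v) - h\<^sup>2 |v|\<^sup>2\<close>. The error therefore consists of the remainder of the squared
  positive part, at most \<open>k\<^sup>2\<close>, and of the contribution of the quadratic term of \<open>k\<close> to the linear
  part. Both are bounded uniformly in \<open>z\<close> on bounded sets, as integration over \<open>z\<close> requires.\<close>

lemma bump_shift_remainder:
  assumes h: "\<bar>h\<bar> \<le> 1" and z: "norm z \<le> R"
  shows "\<bar>bump \<epsilon> (z - h *\<^sub>R v) - bump \<epsilon> z - 4 * max 0 (\<epsilon>\<^sup>2 - z \<bullet> z) * (z \<bullet> v) * h\<bar>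
     \<le> ((2 * R * norm v + (norm v)\<^sup>2)\<^sup>2 + 2 * (norm v)\<^sup>2 * \<epsilon>\<^sup>2) * h\<^sup>2"
proof -
  define s where "s = \<epsilon>\<^sup>2 - z \<bullet> z"
  define k where "k = h * (2 * (z \<bullet> v) - h * (v \<bullet> v))"
  have "\<epsilon>\<^sup>2 - (z - h *\<^sub>R v) \<bullet> (z - h *\<^sub>R v) = s + k"
    by (simp add: s_def k_def inner_diff inner_commute algebra_simps)
  then have "bump \<epsilon> (z - h *\<^sub>R v) = (max 0 (s + k))\<^sup>2" "bump \<epsilon> z = (max 0 s)\<^sup>2"
    by (simp_all add: bump_def s_def)
  moreover have "2 * k * max 0 s = 4 * max 0 s * (z \<bullet> v) * h - 2 * (v \<bullet> v) * max 0 s * h\<^sup>2"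
    by (simp add: k_def power2_eq_square algebra_simps)
  ultimately have split: "bump \<epsilon> (z - h *\<^sub>R v) - bump \<epsilon> z - 4 * max 0 s * (z \<bullet> v) * h
      = ((max 0 (s + k))\<^sup>2 - (max 0 s)\<^sup>2 - 2 * k * max 0 s) - 2 * (v \<bullet> v) * max 0 s * h\<^sup>2"
    by simp
  have "\<bar>2 * (z \<bullet> v) - h * (v \<bullet> v)\<bar> \<le> 2 * R * norm v + (norm v)\<^sup>2"
  proof -
    have "\<bar>z \<bullet> v\<bar> \<le> R * norm v"
      using Cauchy_Schwarz_ineq2[of z v] z mult_right_mono[OF z, of "norm v"] by simp
    moreover have "\<bar>h * (v \<bullet> v)\<bar> \<le> (norm v)\<^sup>2"
      using h mult_right_mono[OF h, of "v \<bullet> v"] by (simp add: abs_mult power2_norm_eq_inner)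
    ultimately show ?thesis by linarith
  qed
  then have "(2 * (z \<bullet> v) - h * (v \<bullet> v))\<^sup>2 \<le> (2 * R * norm v + (norm v)\<^sup>2)\<^sup>2"
    by (rule abs_le_square_iff[THEN iffD1, OF order_trans]) simp
  then have k2: "k\<^sup>2 \<le> (2 * R * norm v + (norm v)\<^sup>2)\<^sup>2 * h\<^sup>2"
    unfolding k_def power_mult_distrib by (subst mult.commute) (rule mult_right_mono, simp_all)
  have "0 \<le> 2 * (v \<bullet> v) * max 0 s * h\<^sup>2"
    by simp
  moreover have "2 * (v \<bullet> v) * max 0 s * h\<^sup>2 \<le> 2 * (norm v)\<^sup>2 * \<epsilon>\<^sup>2 * h\<^sup>2"
    by (intro mult_right_mono mult_mono) (auto simp: s_def power2_norm_eq_inner)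
  ultimately show ?thesis
    using max_zero_square_remainder[of s k] k2 unfolding s_def[symmetric] split distrib_right
    by linarith
qed

text \<open>A bump times a constant vector \<open>v\<close> is an admissible test field whose divergence is, up to the
  factor \<open>c\<close>, the derivative of the bump in direction \<open>v\<close>. That factor serves to bring the norm of
  the field below \<open>1\<close> and to reverse its sign.\<close>

lemma scaled_bump_in_C1c:
  fixes v :: "'a::euclidean_space"
  assumes "0 < \<epsilon>" "cball y \<epsilon> \<subseteq> \<Omega>"
  shows "(\<lambda>x. (c * bump \<epsilon> (x - y)) *\<^sub>R v) \<in> C1c \<Omega>" (is "?\<phi> \<in> _")
    and "divergence (\<lambda>x. (c * bump \<epsilon> (x - y)) *\<^sub>R v) x =
      - c * (4 * max 0 (\<epsilon>\<^sup>2 - (x - y) \<bullet> (x - y)) * ((x - y) \<bullet> v))"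
proof -
  define D :: "'a \<Rightarrow> 'a \<Rightarrow>\<^sub>L 'a" where
    "D x = (- c * (4 * max 0 (\<epsilon>\<^sup>2 - (x - y) \<bullet> (x - y)))) *\<^sub>R
             (blinfun_scaleR_left v o\<^sub>L blinfun_inner_right (x - y))" for x
  have der: "(?\<phi> has_derivative blinfun_apply (D x)) (at x)" for x
    by (rule has_derivative_eq_rhs, rule has_derivative_scaleR_left,
        rule has_derivative_mult_right, rule bump_has_derivative)
       (auto simp: D_def blinfun.scaleR_left blinfun.minus_left fun_eq_iff)
  have cont: "continuous_on UNIV D"
    unfolding D_def
    by (intro continuous_intros bounded_linear.continuous_on[OF bounded_linear_blinfun_inner_right]
        bounded_bilinear.continuous_on[OF bounded_bilinear_blinfun_compose])
  have "{x. ?\<phi> x \<noteq> 0} \<subseteq> cball y \<epsilon>"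
    using bump_eq_0_iff[OF assms(1)] by (force simp: dist_norm norm_minus_commute)
  then have "closure {x. ?\<phi> x \<noteq> 0} \<subseteq> cball y \<epsilon>"
    by (rule closure_minimal) simp
  then have "compact (closure {x. ?\<phi> x \<noteq> 0})" "closure {x. ?\<phi> x \<noteq> 0} \<subseteq> \<Omega>"
    using assms(2) bounded_subset[OF bounded_cball] by (auto simp: compact_eq_bounded_closed)
  with der cont show "?\<phi> \<in> C1c \<Omega>"
    unfolding C1c_def by blast
  have "frechet_derivative ?\<phi> (at x) = blinfun_apply (D x)"
    using frechet_derivative_at[OF der] by simp
  then show "divergence ?\<phi> x =
      - c * (4 * max 0 (\<epsilon>\<^sup>2 - (x - y) \<bullet> (x - y)) * ((x - y) \<bullet> v))"
    unfolding divergence_def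
    by (simp add: D_def blinfun.scaleR_left blinfun.minus_left euclidean_inner[of "x - y" v]
        sum_distrib_left sum_distrib_right sum_negf mult_ac)
qed

text \<open>If the supremum in the definition of the perimeter is \<open>0\<close>, no test field gives a positive value;
  as the negative of a test field is again one, all values are \<open>0\<close>.\<close>

lemma zero_perimeter_bump_moment:
  assumes per: "Per E \<Omega> = 0" and \<epsilon>: "0 < \<epsilon>" "cball y \<epsilon> \<subseteq> \<Omega>"
  shows "(LINT x:E \<inter> \<Omega>|lborel. 4 * max 0 (\<epsilon>\<^sup>2 - (x - y) \<bullet> (x - y)) * ((x - y) \<bullet> v)) = 0"
    (is "(LINT x:_|_. ?f x) = 0")
proof -
  \<comment> \<open>\<open>\<epsilon>\<^sup>4\<close> bounds the bump, so this factor makes the test field admissible.\<close>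
  define c where "c = inverse (1 + \<epsilon> ^ 4 * norm v)"
  have "0 < 1 + \<epsilon> ^ 4 * norm v"
    using \<epsilon>(1) by (intro add_pos_nonneg) auto
  then have c: "0 < c" "c * (\<epsilon> ^ 4 * norm v) \<le> 1"
    by (auto simp: c_def field_simps)
  have le: "- d * (LINT x:E \<inter> \<Omega>|lborel. ?f x) \<le> 0" if d: "\<bar>d\<bar> = c" for d
  proof -
    let ?\<phi> = "\<lambda>x. (d * bump \<epsilon> (x - y)) *\<^sub>R v"
    have "norm (?\<phi> x) \<le> 1" for x
    proof -
      have "norm (?\<phi> x) = c * (bump \<epsilon> (x - y) * norm v)"
        by (simp add: abs_mult d bump_nonneg)
      also have "\<dots> \<le> c * (\<epsilon> ^ 4 * norm v)"
        using c(1) by (intro mult_left_mono mult_right_mono bump_le) auto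
      finally show ?thesis using c(2) by simp
    qed
    then have le: "ereal (LINT x:\<Omega>|lborel. indicator E x * divergence ?\<phi> x) \<le> 0"
      unfolding per[symmetric] Per_def TV_def
      using scaled_bump_in_C1c(1)[OF \<epsilon>] by (intro SUP_upper) auto
    have eq: "(LINT x:\<Omega>|lborel. indicator E x * divergence ?\<phi> x)
        = (LINT x|lborel. - d * (indicator (E \<inter> \<Omega>) x * ?f x))"
      unfolding set_lebesgue_integral_def scaled_bump_in_C1c(2)[OF \<epsilon>]
      by (rule Bochner_Integration.integral_cong) (auto simp: indicator_def)
    have eq': "(LINT x|lborel. - d * (indicator (E \<inter> \<Omega>) x * ?f x)) = - d * (LINT x:E \<inter> \<Omega>|lborel. ?f x)"
      unfolding set_lebesgue_integral_def by (subst integral_mult_right_zero) simp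
    from le show ?thesis unfolding eq eq' by simp
  qed
  from le[of c] le[of "- c"] c(1) show ?thesis
    by (simp add: mult_le_0_iff zero_le_mult_iff)
qed

lemma set_integrable_continuous_on_bounded:
  fixes f :: "'a::euclidean_space \<Rightarrow> real"
  assumes "bounded A" "A \<in> sets borel" "continuous_on UNIV f"
  shows "set_integrable lborel A f"
proof -
  have "set_integrable lborel (closure A) f"
    unfolding set_integrable_def
    using assms by (intro borel_integrable_compact continuous_on_subset[OF assms(3)]) auto
  then show ?thesis
    by (rule set_integrable_subset) (use assms closure_subset in auto)
qed

text \<open>The moment in the hypothesis is the formal derivative of \<open>t \<mapsto> \<integral>\<^sub>A bump \<epsilon> (x - a - t v) dx\<close>, and the
  uniform quadratic remainder justifies differentiating under the integral.\<close>

lemma bump_integral_derivative_zero: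
  fixes A :: "'a::euclidean_space set"
  assumes A: "bounded A" "A \<in> sets borel"
    and moment: "(LINT x:A|lborel. 4 * max 0 (\<epsilon>\<^sup>2 - (x - (a + t *\<^sub>R v)) \<bullet> (x - (a + t *\<^sub>R v))) *
        ((x - (a + t *\<^sub>R v)) \<bullet> v)) = 0"
  shows "((\<lambda>t. LINT x:A|lborel. bump \<epsilon> (x - (a + t *\<^sub>R v))) has_real_derivative 0) (at t)"
proof -
  note int = set_integrable_continuous_on_bounded[OF A]
  define g where "g t = (LINT x:A|lborel. bump \<epsilon> (x - (a + t *\<^sub>R v)))" for t
  define z where "z = a + t *\<^sub>R v"
  define f where "f x = 4 * max 0 (\<epsilon>\<^sup>2 - (x - z) \<bullet> (x - z)) * ((x - z) \<bullet> v)" for x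
  have mom: "(LINT x:A|lborel. f x) = 0"
    using moment by (simp add: f_def z_def)
  have contf: "continuous_on UNIV f"
    unfolding f_def by (intro continuous_intros)
  obtain R where R: "\<And>x. x \<in> A \<Longrightarrow> norm x \<le> R"
    using A(1) by (auto simp: bounded_iff)
  define C where "C = (2 * (R + norm z) * norm v + (norm v)\<^sup>2)\<^sup>2 + 2 * (norm v)\<^sup>2 * \<epsilon>\<^sup>2"
  have "(g has_real_derivative 0) (at t)"
  proof (rule has_real_derivative_quadratic_remainder)
    fix h :: real assume h: "\<bar>h\<bar> \<le> 1"
    define d where "d x = bump \<epsilon> (x - z - h *\<^sub>R v) - bump \<epsilon> (x - z)" for x
    have contd: "continuous_on UNIV d"
      unfolding d_def by (intro continuous_intros)
    have intg: "set_integrable lborel A (\<lambda>x. bump \<epsilon> (x - w))" for w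
      by (intro int continuous_intros)
    have intd: "set_integrable lborel A d" "set_integrable lborel A (\<lambda>x. h * f x)"
      "set_integrable lborel A (\<lambda>x. d x - h * f x)"
      "set_integrable lborel A (\<lambda>x. \<bar>d x - h * f x\<bar>)"
      "set_integrable lborel A (\<lambda>x. C * h\<^sup>2 * 1)"
      by (intro int continuous_intros contf contd)+
    have "g (t + h) - g t = (LINT x:A|lborel. d x)"
      using set_integral_diff(2)[OF intg[of "z + h *\<^sub>R v"] intg[of z]]
      by (simp add: g_def z_def d_def algebra_simps)
    also have "\<dots> = (LINT x:A|lborel. d x - h * f x)"
      unfolding set_integral_diff(2)[OF intd(1,2)] set_integral_mult_right mom by simp
    finally have "\<bar>g (t + h) - g t - 0 * h\<bar> \<le> (LINT x:A|lborel. \<bar>d x - h * f x\<bar>)"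
      using set_integral_norm_bound[OF intd(3)] by simp
    also have "\<dots> \<le> (LINT x:A|lborel. C * h\<^sup>2 * 1)"
    proof (rule set_integral_mono[OF intd(4,5)])
      fix x assume "x \<in> A"
      then have "norm (x - z) \<le> R + norm z"
        using R[of x] norm_triangle_ineq4[of x z] by linarith
      from bump_shift_remainder[OF h this, of \<epsilon> v]
      show "\<bar>d x - h * f x\<bar> \<le> C * h\<^sup>2 * 1"
        by (simp add: C_def d_def f_def mult_ac)
    qed
    also have "\<dots> = (C * (LINT x:A|lborel. 1)) * h\<^sup>2"
      unfolding set_integral_mult_right by (simp only: mult_ac)
    finally show "\<bar>g (t + h) - g t - 0 * h\<bar> \<le> (C * (LINT x:A|lborel. 1)) * h\<^sup>2" .
  qed
  then show ?thesis by (simp add: g_def[abs_def])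
qed

text \<open>On the ball of half the radius the bump is at least \<open>(\<epsilon>\<^sup>2 - \<epsilon>\<^sup>2 / 4)\<^sup>2\<close>.\<close>

lemma bump_integral_pos:
  fixes A :: "'a::euclidean_space set"
  assumes A: "bounded A" "A \<in> sets borel" and "0 < \<epsilon>" "ball a \<epsilon> \<subseteq> A"
  shows "0 < (LINT x:A|lborel. bump \<epsilon> (x - a))"
proof -
  let ?B = "ball a (\<epsilon> / 2)" and ?m = "(3 / 4 * \<epsilon>\<^sup>2)\<^sup>2"
  have "?B \<subseteq> ball a \<epsilon>" using assms(3) by (intro subset_ball) simp
  with assms(4) have B: "?B \<subseteq> A" by simp
  have intA: "integrable lborel (\<lambda>x. indicator A x *\<^sub>R bump \<epsilon> (x - a))"
    unfolding set_integrable_def[symmetric]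
    by (intro set_integrable_continuous_on_bounded[OF A] continuous_intros)
  have intB: "set_integrable lborel ?B f" if "continuous_on UNIV f" for f :: "'a \<Rightarrow> real"
    using that by (intro set_integrable_continuous_on_bounded) auto
  have "0 < ?m * measure lborel ?B"
    using assms(3) content_ball_pos[of "\<epsilon> / 2" a] by simp
  also have "\<dots> = (LINT x:?B|lborel. ?m)"
    using emeasure_bounded_finite[of ?B]
    by (simp add: set_lebesgue_integral_def)
  also have "\<dots> \<le> (LINT x:?B|lborel. bump \<epsilon> (x - a))"
  proof (rule set_integral_mono)
    fix x assume "x \<in> ?B"
    then have "(norm (x - a))\<^sup>2 \<le> (\<epsilon> / 2)\<^sup>2"
      by (intro power_mono) (auto simp: dist_norm norm_minus_commute)
    then have "3 / 4 * \<epsilon>\<^sup>2 \<le> \<epsilon>\<^sup>2 - (x - a) \<bullet> (x - a)"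
      by (simp add: power2_norm_eq_inner power_divide)
    then have "3 / 4 * \<epsilon>\<^sup>2 \<le> max 0 (\<epsilon>\<^sup>2 - (x - a) \<bullet> (x - a))"
      by (rule order_trans) simp
    then show "?m \<le> bump \<epsilon> (x - a)"
      unfolding bump_def by (rule power_mono) simp
  qed (intro intB continuous_intros)+
  also have "\<dots> \<le> (LINT x:A|lborel. bump \<epsilon> (x - a))"
    unfolding set_lebesgue_integral_def
  proof (rule integral_mono[OF _ intA])
    show "integrable lborel (\<lambda>x. indicator ?B x *\<^sub>R bump \<epsilon> (x - a))"
      unfolding set_integrable_def[symmetric] by (intro intB continuous_intros)
    show "indicator ?B x *\<^sub>R bump \<epsilon> (x - a) \<le> indicator A x *\<^sub>R bump \<epsilon> (x - a)" for x
      using B by (auto simp: indicator_def bump_nonneg)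
  qed
  finally show ?thesis .
qed

text \<open>Constancy of a set of zero perimeter, in topological form: at a point of \<open>\<Omega>\<close> violating the
  inclusion, every neighbourhood contains a ball inside \<open>E\<close> and a ball disjoint from \<open>E\<close>. Moving a
  bump from the first to the second changes its integral over \<open>E\<close> from a positive value to \<open>0\<close>,
  although the derivative vanishes along the way.\<close>

lemma zero_perimeter_closure:
  fixes \<Omega> :: "'a::euclidean_space set"
  assumes \<Omega>: "open \<Omega>" "bounded \<Omega>" and E: "open E" and per: "Per E \<Omega> = 0"
  shows "\<Omega> \<inter> closure E \<subseteq> interior (closure E)"
proof (rule subsetI, rule ccontr)
  fix y assume y: "y \<in> \<Omega> \<inter> closure E" and ny: "y \<notin> interior (closure E)"
  obtain r' where r': "0 < r'" "ball y r' \<subseteq> \<Omega>"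
    using \<Omega>(1) y open_contains_ball by blast
  \<comment> \<open>Centres stay within \<open>r\<close> of \<open>y\<close> and bump radii are at most \<open>r\<close>, so supports stay in \<open>\<Omega>\<close>.\<close>
  define r where "r = r' / 2"
  have r: "0 < r" "ball y (2 * r) \<subseteq> \<Omega>"
    using r' by (auto simp: r_def)
  obtain a where a: "a \<in> E" "a \<in> ball y r"
    using y r(1) by (auto simp: closure_approachable dist_commute)
  have "\<not> ball y r \<subseteq> closure E"
    using ny r(1) by (auto simp: mem_interior)
  then obtain b where b: "b \<in> ball y r" "b \<notin> closure E"
    by blast
  obtain \<epsilon>1 where \<epsilon>1: "0 < \<epsilon>1" "ball a \<epsilon>1 \<subseteq> E"
    using E a(1) open_contains_ball by blast
  obtain \<epsilon>2 where \<epsilon>2: "0 < \<epsilon>2" "ball b \<epsilon>2 \<subseteq> - closure E"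
    using b(2) open_contains_ball[of "- closure E"] by auto
  define \<epsilon> where "\<epsilon> = min r (min \<epsilon>1 \<epsilon>2)"
  have \<epsilon>: "0 < \<epsilon>" "\<epsilon> \<le> r" "ball a \<epsilon> \<subseteq> E" "ball b \<epsilon> \<inter> E = {}"
    using r \<epsilon>1 \<epsilon>2 closure_subset[of E] by (auto simp: \<epsilon>_def)
  have near: "cball z \<epsilon> \<subseteq> \<Omega>" if "z \<in> ball y r" for z
  proof
    fix w assume "w \<in> cball z \<epsilon>"
    then have "dist y w < 2 * r"
      using that \<epsilon>(2) dist_triangle[of y w z] by (simp add: dist_commute)
    then show "w \<in> \<Omega>" using r(2) by auto
  qed
  define A where "A = E \<inter> \<Omega>"
  have "bounded A"
    unfolding A_def using \<Omega>(2) by (rule bounded_subset) simp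
  moreover have "A \<in> sets borel"
    using \<Omega> E by (simp add: A_def)
  ultimately have A: "bounded A" "A \<in> sets borel" .
  define v where "v = b - a"
  define g where "g t = (LINT x:A|lborel. bump \<epsilon> (x - (a + t *\<^sub>R v)))" for t
  have "(g has_real_derivative 0) (at t)" if t: "0 \<le> t" "t \<le> 1" for t
  proof -
    have "(1 - t) *\<^sub>R a + t *\<^sub>R b \<in> ball y r"
      using convexD_alt[OF convex_ball a(2) b(1) t] .
    moreover have "(1 - t) *\<^sub>R a + t *\<^sub>R b = a + t *\<^sub>R v"
      by (simp add: v_def algebra_simps)
    ultimately have "a + t *\<^sub>R v \<in> ball y r" by simp
    from zero_perimeter_bump_moment[OF per \<epsilon>(1) near[OF this], of v]
    show ?thesis
      unfolding g_def[abs_def] A_def[symmetric] by (rule bump_integral_derivative_zero[OF A])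
  qed
  then have "g 1 = g 0"
    using MVT2[of 0 1 g "\<lambda>_. 0"] by auto
  moreover have "g 1 = 0"
  proof -
    have zero: "bump \<epsilon> (x - b) = 0" if "x \<in> A" for x
    proof -
      have "x \<notin> ball b \<epsilon>" using that \<epsilon>(4) by (auto simp: A_def)
      then show ?thesis
        by (subst bump_eq_0_iff[OF \<epsilon>(1)]) (simp add: dist_norm norm_minus_commute not_less)
    qed
    have "indicator A x *\<^sub>R bump \<epsilon> (x - (a + 1 *\<^sub>R (b - a))) = 0" for x
      using zero[of x] by (simp add: indicator_def)
    then show ?thesis
      unfolding g_def v_def set_lebesgue_integral_def by (simp only: integral_zero)
  qed
  moreover have "ball a \<epsilon> \<subseteq> A"
    using \<epsilon>(3) near[OF a(2)] ball_subset_cball[of a \<epsilon>] by (auto simp: A_def)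
  then have "0 < g 0"
    using bump_integral_pos[OF A \<epsilon>(1)] by (simp add: g_def)
  ultimately show False by simp
qed

section \<open>Simplex sets of zero perimeter\<close>

text \<open>Since \<open>\<Omega>\<close> lies on one side of its boundary, moving from a boundary point in the direction \<open>- e\<close>
  leads below the graph and thus off the closure of \<open>\<Omega>\<close>. This excludes slits and punctures, for
  which the closure would have interior points outside \<open>\<Omega>\<close>.\<close>

lemma interior_closure_strongly_lipschitz:
  fixes \<Omega> :: "'a::euclidean_space set"
  assumes "open \<Omega>" "strongly_lipschitz_boundary \<Omega>"
  shows "interior (closure \<Omega>) = \<Omega>"
proof (rule antisym)
  show "\<Omega> \<subseteq> interior (closure \<Omega>)"
    using assms(1) by (simp add: closure_subset interior_maximal)
  show "interior (closure \<Omega>) \<subseteq> \<Omega>"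
  proof (rule subsetI, rule ccontr)
    fix x assume x: "x \<in> interior (closure \<Omega>)" "x \<notin> \<Omega>"
    have "x \<in> frontier \<Omega>"
      using x interior_subset[of "closure \<Omega>"] assms(1) by (auto simp: frontier_def interior_open)
    from bspec[OF assms(2)[unfolded strongly_lipschitz_boundary_def] this]
    obtain U e g L where U: "open U" "x \<in> U" and e: "norm e = 1"
      and g: "L-lipschitz_on {z. z \<bullet> e = 0} (g :: 'a \<Rightarrow> real)"
      and graph: "\<Omega> \<inter> U = {y \<in> U. y \<bullet> e > g (y - (y \<bullet> e) *\<^sub>R e)}"
      by (elim exE conjE) (rule that)
    have ee: "e \<bullet> e = 1" using e by (simp add: norm_eq_1)
    \<comment> \<open>The signed distance in direction \<open>e\<close> from \<open>y\<close> up to the graph.\<close>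
    define h where "h y = g (y - (y \<bullet> e) *\<^sub>R e) - y \<bullet> e" for y
    have "continuous_on UNIV (\<lambda>y. g (y - (y \<bullet> e) *\<^sub>R e))"
      by (rule continuous_on_compose2[OF lipschitz_on_continuous_on[OF g]])
         (auto intro!: continuous_intros simp: inner_diff_left ee)
    then have h: "continuous_on UNIV h"
      unfolding h_def by (intro continuous_intros)
    have above: "y \<in> \<Omega> \<longleftrightarrow> h y < 0" if "y \<in> U" for y
    proof -
      have "y \<in> \<Omega> \<longleftrightarrow> y \<in> \<Omega> \<inter> U" using that by simp
      then show ?thesis unfolding graph using that by (simp add: h_def)
    qed
    have hx: "0 \<le> h x"
      using x(2) above[OF U(2)] by simp
    define V where "V = U \<inter> interior (closure \<Omega>)"
    have "open V" "x \<in> V" using U x by (auto simp: V_def)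
    then obtain \<delta> where \<delta>: "0 < \<delta>" "ball x \<delta> \<subseteq> V"
      using open_contains_ball by blast
    define w where "w = x - (\<delta> / 2) *\<^sub>R e"
    have wV: "w \<in> V"
      using \<delta>(1) e by (intro subsetD[OF \<delta>(2)]) (simp add: w_def dist_norm)
    have "w - (w \<bullet> e) *\<^sub>R e = x - (x \<bullet> e) *\<^sub>R e" "w \<bullet> e = x \<bullet> e - \<delta> / 2"
      by (simp_all add: w_def inner_diff_left ee scaleR_diff_left)
    then have "h w = h x + \<delta> / 2"
      by (simp add: h_def)
    then have "w \<in> V \<inter> {y. 0 < h y}"
      using wV hx \<delta> by simp
    moreover have "open (V \<inter> {y. 0 < h y})"
      using \<open>open V\<close> h by (intro open_Int open_Collect_less continuous_intros) auto
    moreover have "(V \<inter> {y. 0 < h y}) \<inter> \<Omega> = {}"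
      using above by (fastforce simp: V_def)
    ultimately have "w \<notin> closure \<Omega>"
      using open_Int_closure_eq_empty[of "V \<inter> {y. 0 < h y}" \<Omega>] by blast
    then show False using wV interior_subset[of "closure \<Omega>"] by (auto simp: V_def)
  qed
qed

lemma simplex_sets_subset_domain:
  assumes "polyhedral_lipschitz_domain \<Omega>" "domain_triangulation \<Omega> \<T>" "E \<in> simplex_sets \<T>"
  shows "E \<subseteq> \<Omega>"
proof -
  obtain \<C> where "\<C> \<subseteq> \<T>" "E = interior (\<Union>T\<in>\<C>. closure T)"
    using assms(3) by (auto simp: simplex_sets_def)
  moreover have "closure \<Omega> = (\<Union>T\<in>\<T>. closure T)"
    using assms(2) by (simp add: domain_triangulation_def)
  ultimately have "E \<subseteq> interior (closure \<Omega>)"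
    using interior_mono[of "\<Union>T\<in>\<C>. closure T" "\<Union>T\<in>\<T>. closure T"] by auto
  then show ?thesis
    using assms(1) interior_closure_strongly_lipschitz[of \<Omega>]
    by (simp add: polyhedral_lipschitz_domain_def)
qed

text \<open>As the interior of a closed set, \<open>E\<close> equals the interior of its closure, so that
  \<open>zero_perimeter_closure\<close> makes it clopen relative to the connected set \<open>\<Omega>\<close>.\<close>

lemma simplex_set_zero_perimeter:
  assumes dom: "polyhedral_lipschitz_domain \<Omega>" and tri: "domain_triangulation \<Omega> \<T>"
    and E: "E \<in> simplex_sets \<T>" and per: "Per E \<Omega> = 0"
  shows "E = {} \<or> E = \<Omega>"
proof -
  have \<Omega>: "open \<Omega>" "bounded \<Omega>" "connected \<Omega>"
    using dom by (auto simp: polyhedral_lipschitz_domain_def)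
  have sub: "E \<subseteq> \<Omega>"
    using simplex_sets_subset_domain[OF dom tri E] .
  obtain \<C> where \<C>: "\<C> \<subseteq> \<T>" "E = interior (\<Union>T\<in>\<C>. closure T)"
    using E by (auto simp: simplex_sets_def)
  have "finite \<C>"
    using \<C>(1) tri finite_subset by (auto simp: domain_triangulation_def)
  then have "closed (\<Union>T\<in>\<C>. closure T)"
    by auto
  then have regular: "interior (closure E) \<subseteq> E"
    unfolding \<C>(2) by (intro interior_mono closure_minimal interior_subset)
  have "open E" using \<C>(2) by simp
  then have "\<Omega> \<inter> closure E \<subseteq> E"
    using zero_perimeter_closure[OF \<Omega>(1,2) _ per] regular by blast
  then have rel_closed: "\<Omega> \<inter> closure E = E"
    using sub closure_subset[of E] by blast
  have "closedin (top_of_set \<Omega>) (\<Omega> \<inter> closure E)"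
    by (rule closedin_closed_Int) simp
  then have "closedin (top_of_set \<Omega>) E"
    unfolding rel_closed .
  moreover have "openin (top_of_set \<Omega>) E"
    using \<open>open E\<close> sub by (simp add: open_subset)
  ultimately show ?thesis
    using \<Omega>(3)[unfolded connected_clopen] by blast
qed

lemma zero_in_C1c: "(\<lambda>_. 0) \<in> C1c (\<Omega> :: 'a::euclidean_space set)"
proof -
  have "((\<lambda>_. 0) has_derivative blinfun_apply (0 :: 'a \<Rightarrow>\<^sub>L 'a)) (at x)" for x :: 'a
    by (rule has_derivative_eq_rhs[OF has_derivative_const]) (simp add: fun_eq_iff)
  then show ?thesis
    unfolding C1c_def by (auto intro!: exI[of _ "\<lambda>_. 0"])
qed

lemma divergence_zero: "divergence (\<lambda>_. 0) x = 0"
  by (simp add: divergence_def frechet_derivative_const)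

lemma Per_nonneg: "0 \<le> Per E \<Omega>"
  unfolding Per_def TV_def
  by (rule SUP_upper2[of "\<lambda>_. 0"]) (auto simp: zero_in_C1c divergence_zero set_lebesgue_integral_def)

lemma Per_empty: "Per {} \<Omega> = 0"
proof (rule antisym[OF _ Per_nonneg])
  show "Per {} \<Omega> \<le> 0"
    unfolding Per_def TV_def by (rule SUP_least) (simp add: set_lebesgue_integral_def)
qed

lemma finite_simplex_sets: "finite \<T> \<Longrightarrow> finite (simplex_sets \<T>)"
  by (rule finite_subset[of _ "(\<lambda>\<C>. interior (\<Union>T\<in>\<C>. closure T)) ` Pow \<T>"])
     (auto simp: simplex_sets_def)

lemma empty_in_simplex_sets: "{} \<in> simplex_sets \<T>"
  unfolding simplex_sets_def by (auto intro!: exI[of _ "{}"])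

section \<open>The mean of the dual variable\<close>

lemma subspace_P0: "subspace (P0 \<T>)"
  unfolding subspace_def
proof (intro conjI ballI allI)
  show "0 \<in> P0 \<T>"
    by (auto simp: P0_def constant_on_def)
next
  fix u v assume "u \<in> P0 \<T>" "v \<in> P0 \<T>"
  then show "u + v \<in> P0 \<T>"
    by (fastforce simp: P0_def constant_on_def)
next
  fix c :: real and u assume "u \<in> P0 \<T>"
  then show "c *\<^sub>R u \<in> P0 \<T>"
    by (fastforce simp: P0_def constant_on_def scaleR_fun_def)
qed

lemma one_P0_in_P0: "one_P0 \<T> \<in> P0 \<T>"
  by (auto simp: P0_def one_P0_def constant_on_def indicator_def)

lemma bounded_linear_on_P0_combination:
  assumes K: "bounded_linear_on_P0 \<Omega> \<T> K" and A: "A \<subseteq> P0 \<T>"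
  shows "K (\<Sum>w\<in>A. \<gamma> w *\<^sub>R w) = (\<Sum>w\<in>A. \<gamma> w *\<^sub>R K w)"
proof -
  have "K (0 *\<^sub>R one_P0 \<T>) = 0 *\<^sub>R K (one_P0 \<T>)"
    using K one_P0_in_P0 unfolding bounded_linear_on_P0_def by blast
  then have K0: "K 0 = 0"
    by (simp only: scaleR_zero_left)
  show ?thesis
    using A
  proof (induction A rule: infinite_finite_induct)
    case (insert w A)
    have "(\<Sum>w\<in>A. \<gamma> w *\<^sub>R w) \<in> P0 \<T>" "\<gamma> w *\<^sub>R w \<in> P0 \<T>"
      using insert.prems subspace_P0[of \<T>] by (auto intro!: subspace_sum subspace_scale)
    then have "K (\<gamma> w *\<^sub>R w + (\<Sum>w\<in>A. \<gamma> w *\<^sub>R w)) = \<gamma> w *\<^sub>R K w + K (\<Sum>w\<in>A. \<gamma> w *\<^sub>R w)"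
      using insert.prems K unfolding bounded_linear_on_P0_def by simp
    then show ?case
      using insert by (simp only: sum.insert insert_subset simp_thms)
  next
    case empty
    show ?case by (simp only: K0 sum.empty)
  next
    case (infinite A)
    show ?case by (simp only: K0 sum.infinite[OF infinite(1)])
  qed
qed

text \<open>Every subproblem, including the initial one, minimizes over the coefficient of the constant
  function without constraint, and the penalty does not see that coefficient. Finiteness of the
  active set and its inclusion in \<open>P0 \<T>\<close> are the invariants under which \<open>K\<close> can be moved inside
  the sum that defines the next iterate.\<close>

lemma fc_gcg_iterate_minimizes_along_constants:
  assumes run: "fc_gcg_iterate \<Omega> \<T> K F k A u" and K: "bounded_linear_on_P0 \<Omega> \<T> K"
  shows "finite A \<and> A \<subseteq> P0 \<T> \<and> (\<forall>c. F (K u) \<le> F (K u + c *\<^sub>R K (one_P0 \<T>)))"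
  using run
proof induction
  case (init c)
  have "K (c *\<^sub>R one_P0 \<T>) = c *\<^sub>R K (one_P0 \<T>)"
    using K one_P0_in_P0 unfolding bounded_linear_on_P0_def by blast
  then show ?case
    using init by (simp add: is_arg_min_linorder scaleR_add_left[symmetric])
next
  case (step k A u p v A_plus \<gamma> c)
  have "v \<in> P0 \<T>"
    using step by (auto simp: extreme_point_of_def TV_unit_ball_def)
  then have A: "finite A_plus" "A_plus \<subseteq> P0 \<T>"
    using step by auto
  let ?s = "\<Sum>w\<in>A_plus. \<gamma> w *\<^sub>R w" and ?one = "one_P0 \<T>"
  have "?s \<in> P0 \<T>" "c *\<^sub>R ?one \<in> P0 \<T>"
    using A subspace_P0[of \<T>] one_P0_in_P0 by (auto intro!: subspace_sum subspace_scale)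
  then have Ku: "K (?s + c *\<^sub>R ?one) = (\<Sum>w\<in>A_plus. \<gamma> w *\<^sub>R K w) + c *\<^sub>R K ?one"
    using K one_P0_in_P0[of \<T>] bounded_linear_on_P0_combination[OF K A(2)]
    by (simp add: bounded_linear_on_P0_def)
  have min: "F (K (?s + c *\<^sub>R ?one)) \<le> F (K (?s + c *\<^sub>R ?one) + d *\<^sub>R K ?one)" for d
  proof -
    let ?J = "\<lambda>(\<gamma>, c). F ((\<Sum>w\<in>A_plus. \<gamma> w *\<^sub>R K w) + c *\<^sub>R K ?one) + (\<Sum>w\<in>A_plus. \<gamma> w)"
    have "?J (\<gamma>, c) \<le> ?J (\<gamma>, c + d)"
      using step.hyps(7) unfolding is_arg_min_linorder by auto
    then show ?thesis
      unfolding Ku by (simp add: scaleR_add_left add.assoc)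
  qed
  have "finite {w \<in> A_plus. \<gamma> w \<noteq> 0}" "{w \<in> A_plus. \<gamma> w \<noteq> 0} \<subseteq> P0 \<T>"
    using A by auto
  then show ?case by (intro conjI allI min)
qed

text \<open>Fermat's rule in the direction of the constant function; the adjoint relation turns the vanishing
  derivative into the vanishing mean of \<open>p\<close>.\<close>

lemma dual_variable_integral_zero:
  assumes run: "fc_gcg_iterate \<Omega> \<T> K F k A u" and K: "bounded_linear_on_P0 \<Omega> \<T> K"
    and dual: "dual_variable \<Omega> \<T> K F u p"
  shows "(LINT x:\<Omega>|lborel. p x) = 0"
proof -
  let ?one = "one_P0 \<T>"
  obtain g where p: "p \<in> P0 \<T>" and g: "GDERIV F (K u) :> g"
    and adj: "\<And>v. v \<in> P0 \<T> \<Longrightarrow> (LINT x:\<Omega>|lborel. p x * v x) = - (g \<bullet> K v)"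
    using dual unfolding dual_variable_def by blast
  have lin: "((\<lambda>c. K u + c *\<^sub>R K ?one) has_derivative (\<lambda>c. c *\<^sub>R K ?one)) (at 0)"
    by (auto intro!: derivative_eq_intros)
  have "((\<lambda>c. F (K u + c *\<^sub>R K ?one)) has_derivative (\<lambda>c. (c *\<^sub>R K ?one) \<bullet> g)) (at 0)"
    using has_derivative_compose[OF lin, of F "\<lambda>h. h \<bullet> g"] g by (simp add: gderiv_def)
  then have "((\<lambda>c. F (K u + c *\<^sub>R K ?one)) has_real_derivative (K ?one \<bullet> g)) (at 0)"
    by (simp add: has_field_derivative_def mult_commute_abs)
  then have "K ?one \<bullet> g = 0"
    using fc_gcg_iterate_minimizes_along_constants[OF run K]
    by (intro DERIV_local_min[of _ _ 0 1]) auto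
  moreover have "(\<lambda>x. p x * ?one x) = p"
    using p by (auto simp: fun_eq_iff P0_def one_P0_def indicator_def)
  ultimately show ?thesis
    using adj[OF one_P0_in_P0] by (simp only: inner_commute minus_zero)
qed

section \<open>Finite termination of the Dinkelbach--Newton iteration\<close>

text \<open>The combinatorial core, for an arbitrary finite family \<open>S\<close> with numerators \<open>I\<close> and nonnegative,
  possibly infinite denominators \<open>P\<close>. The element \<open>X0\<close> of zero denominator plays the part of the
  empty set: it makes the minimal value nonpositive, so that a nonzero minimum is negative and an
  infinite denominator cannot belong to a minimizer.\<close>

lemma dinkelbach_finite_termination:
  fixes S :: "'b set" and P :: "'b \<Rightarrow> ereal" and I :: "'b \<Rightarrow> real" and lams :: "nat \<Rightarrow> real"
  defines "obj \<equiv> \<lambda>lam X. P X - ereal (lam * I X)"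
  defines "G \<equiv> \<lambda>lam. Min (obj lam ` S)"
  defines "R \<equiv> {I X / real_of_ereal (P X) |X. X \<in> S \<and> P X \<noteq> 0}"
  assumes S: "finite S" "X0 \<in> S" "P X0 = 0"
    and P: "\<And>X. X \<in> S \<Longrightarrow> 0 \<le> P X"
    and null: "\<And>X. X \<in> S \<Longrightarrow> P X = 0 \<Longrightarrow> I X = 0"
    and R: "R \<noteq> {}" "1 \<le> Max R"
    and start: "lams 0 = 1"
    and step: "\<And>l. \<forall>j<l. G (lams j) \<noteq> 0 \<Longrightarrow>
        is_arg_min (obj (lams l)) (\<lambda>X. X \<in> S) (E l) \<and>
        (G (lams l) \<noteq> 0 \<longrightarrow> lams (Suc l) = real_of_ereal (P (E l)) / I (E l))"
  shows "\<exists>L. (\<forall>l<L. G (lams l) \<noteq> 0) \<and> G (lams L) = 0 \<and> lams L = inverse (Max R)"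
proof -
  define M where "M = Max R"
  have finR: "finite R"
    by (rule finite_subset[of _ "(\<lambda>X. I X / real_of_ereal (P X)) ` S"])
       (use S(1) in \<open>auto simp: R_def\<close>)
  have M: "1 \<le> M" "M \<in> R" "\<And>r. r \<in> R \<Longrightarrow> r \<le> M"
    using R finR by (auto simp: M_def)
  obtain Y where Y: "Y \<in> S" "P Y \<noteq> 0" "M = I Y / real_of_ereal (P Y)"
    using M(2) by (auto simp: R_def)
  define p where "p = real_of_ereal (P Y)"
  have "p \<noteq> 0" using M(1) Y(3) by (auto simp: p_def)
  then have PY: "P Y = ereal p"
    by (cases "P Y") (auto simp: p_def)
  have p: "0 < p" using P[OF Y(1)] PY \<open>p \<noteq> 0\<close> by auto
  have IY: "I Y = M * p" using Y(3) p by (simp add: p_def)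
  have G_nonpos: "G lam \<le> 0" for lam
  proof -
    have "G lam \<le> obj lam X0"
      unfolding G_def using S by (intro Min_le) auto
    then show ?thesis using S(3) null[OF S(2,3)] by (simp add: obj_def)
  qed
  \<comment> \<open>A root of \<open>G\<close> cannot exceed the value at which the objective of the optimal \<open>Y\<close> vanishes.\<close>
  have root_le: "lam \<le> inverse M" if "G lam = 0" for lam
  proof -
    have "0 \<le> obj lam Y"
      using that S(1) Y(1) unfolding G_def by (metis Min_le finite_imageI imageI)
    then have "lam * M * p \<le> 1 * p"
      by (simp add: obj_def PY IY mult_ac)
    then show ?thesis using p M(1) by (simp add: field_simps)
  qed
  \<comment> \<open>The objective is negative at the minimizer, which gives \<open>q < lam\<close>; since \<open>1 / q\<close> is one of the
    ratios, it does not exceed \<open>M\<close>.\<close>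
  have newton: "inverse M \<le> q \<and> q < lam \<and> q \<in> inverse ` R"
    if "0 < lam" "is_arg_min (obj lam) (\<lambda>X. X \<in> S) X" "G lam \<noteq> 0"
      and q: "q = real_of_ereal (P X) / I X" for lam X q
  proof -
    have X: "X \<in> S" "\<And>Z. Z \<in> S \<Longrightarrow> obj lam X \<le> obj lam Z"
      using that(2) by (auto simp: is_arg_min_linorder)
    then have "obj lam X \<le> G lam"
      unfolding G_def using S by (subst Min_ge_iff) auto
    moreover have "G lam < 0"
      using G_nonpos[of lam] that(3) by (simp add: less_le)
    ultimately have neg: "obj lam X < 0"
      by (rule le_less_trans)
    obtain s where s: "P X = ereal s"
      using neg P[OF X(1)] by (cases "P X") (auto simp: obj_def)
    have "0 \<le> s" "s < lam * I X"
      using neg P[OF X(1)] s by (auto simp: obj_def)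
    moreover have "s \<noteq> 0"
      using null[OF X(1)] s \<open>s < lam * I X\<close> by auto
    ultimately have "0 < s" "0 < I X"
      using that(1) by (auto simp: zero_less_mult_iff dest: le_less_trans)
    moreover have r: "I X / s \<in> R"
      using X(1) s \<open>s \<noteq> 0\<close> unfolding R_def by force
    moreover have q': "q = inverse (I X / s)"
      using q s by simp
    ultimately have "inverse M \<le> q \<and> q < lam"
      using M(3)[OF r] M(1) \<open>s < lam * I X\<close> by (auto simp: field_simps)
    then show ?thesis using image_eqI[of q inverse, OF q' r] by simp
  qed
  have lower: "inverse M \<le> lams l" if "\<forall>j<l. G (lams j) \<noteq> 0" for l
    using that
  proof (induction l)
    case 0
    then show ?case using M(1) by (simp add: start field_simps)
  next
    case (Suc l)
    then have "inverse M \<le> lams l" by simp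
    then have "0 < lams l"
      using M(1) by (smt (verit) positive_imp_inverse_positive)
    then show ?case
      using newton step[of l] Suc.prems by auto
  qed
  have "\<exists>l. G (lams l) = 0"
  proof (rule ccontr)
    assume "\<nexists>l. G (lams l) = 0"
    then have nz: "G (lams l) \<noteq> 0" for l by blast
    have pos: "0 < lams l" for l
      using lower[of l] nz M(1) by (smt (verit) positive_imp_inverse_positive)
    have *: "lams (Suc l) < lams l \<and> lams (Suc l) \<in> inverse ` R" for l
      using newton[OF pos[of l]] step[of l] nz by auto
    then have "strict_mono (\<lambda>l. - lams (Suc l))"
      by (auto simp: strict_mono_Suc_iff)
    then have "inj (\<lambda>l. lams (Suc l))"
      using strict_mono_imp_inj_on[of "\<lambda>l. - lams (Suc l)" UNIV] by (simp add: inj_on_def)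
    moreover have "range (\<lambda>l. lams (Suc l)) \<subseteq> inverse ` R"
      using * by auto
    ultimately show False
      using finite_imageD[of "\<lambda>l. lams (Suc l)" UNIV] finite_subset[OF _ finite_imageI[OF finR]]
      by blast
  qed
  then obtain L where L: "G (lams L) = 0" "\<forall>l<L. G (lams l) \<noteq> 0"
    using exists_least_iff[of "\<lambda>l. G (lams l) = 0"] by blast
  then show ?thesis
    using root_le[OF L(1)] lower[OF L(2)] L unfolding M_def by (intro exI[of _ L]) simp
qed

theorem proposition4p4:
  fixes \<Omega> :: "'a::euclidean_space set"
    and \<T> :: "'a set set"
    and K :: "('a \<Rightarrow> real) \<Rightarrow> 'y::{real_inner, complete_space}"
    and F :: "'y \<Rightarrow> real"
    and k :: nat
    and A_k :: "('a \<Rightarrow> real) set"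
    and u_k p_k :: "'a \<Rightarrow> real"
    and lams :: "nat \<Rightarrow> real"
    and E :: "nat \<Rightarrow> 'a set"
  assumes "DIM('a) \<ge> 2"
    and "polyhedral_lipschitz_domain \<Omega>"
    and "domain_triangulation \<Omega> \<T>"
    and "separable_space (euclidean :: 'y topology)"
    and "bounded_linear_on_P0 \<Omega> \<T> K"
    and "thrice_continuously_differentiable F"
    and "strictly_convex F"
    and "\<forall>y. 0 \<le> F y"
    and "\<forall>y. \<exists>!c. is_arg_min (\<lambda>c. F (y + c *\<^sub>R K (one_P0 \<T>))) (\<lambda>_. True) c"
    and "fc_gcg_iterate \<Omega> \<T> K F k A_k u_k"
    and "dual_variable \<Omega> \<T> K F u_k p_k"
    and "ratios \<Omega> \<T> p_k \<noteq> {}"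
    and "1 \<le> Max (ratios \<Omega> \<T> p_k)"
    and "dinkelbach_newton \<Omega> \<T> p_k lams E"
  shows "\<exists>L. (\<forall>l<L. dinkelbach_G \<Omega> \<T> p_k (lams l) \<noteq> 0) \<and>
             dinkelbach_G \<Omega> \<T> p_k (lams L) = 0 \<and>
             lams L = lambda_bar \<Omega> \<T> p_k"
proof -
  have tri: "finite \<T>"
    using assms(3) by (simp add: domain_triangulation_def)
  have null: "(LINT x:X|lborel. p_k x) = 0" if "X \<in> simplex_sets \<T>" "Per X \<Omega> = 0" for X
    using simplex_set_zero_perimeter[OF assms(2,3) that]
      dual_variable_integral_zero[OF assms(10,5,11)]
    by (auto simp: set_lebesgue_integral_def)
  note newton = assms(14)[unfolded dinkelbach_newton_def dinkelbach_G_def dinkelbach_objective_def]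
  show ?thesis
    unfolding dinkelbach_G_def dinkelbach_objective_def lambda_bar_def ratios_def
  proof (rule dinkelbach_finite_termination[where E = E and ?X0.0 = "{}"])
    show "finite (simplex_sets \<T>)"
      by (rule finite_simplex_sets[OF tri])
    show "{} \<in> simplex_sets \<T>" "Per {} \<Omega> = 0"
      by (rule empty_in_simplex_sets, rule Per_empty)
    show "0 \<le> Per X \<Omega>" for X
      by (rule Per_nonneg)
    show "(LINT x:X|lborel. p_k x) = 0" if "X \<in> simplex_sets \<T>" "Per X \<Omega> = 0" for X
      using that by (rule null)
  qed (use assms(12,13)[unfolded ratios_def] newton in blast)+
qed

end
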